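(* Fix $0<\delta_*<1/100$. For every $0<\alpha<24/25$ there exist $r_1,r_2>0$ and $L_0>1$ such that, for every $0<\delta\le\delta_*$ and every $L\ge L_0$, $$\mathbb P\left\{\log\left|Df_\omega^{3m}(x,y)\cdot v\right|\le\alpha m\log L-C\right\}\le L^{-r_1m}e^{-r_2C}$$ for every $(x,y)\in\mathbb T^2$, $v\in\mathbb S^1$, $m\ge1$, and $C\ge0$.
   Context: For $L>0$ and $\delta>0$ put $\sigma:=L^{-\delta}$ and $f(x):=L\cos(2\pi x)$. Let $\Omega:=[-\sigma,\sigma]^{\mathbb N_0}$ with the product probability measure $\mathbb P$ whose coordinate marginals are uniform on $[-\sigma,\sigma]$. For $\omega=(\omega_n)_{n\ge0}\in\Omega$ let $f_\omega(x,y)=f_{\omega_0}(x,y)=\bigl(f(x+\omega_0)-y,\;x+\omega_0\bigr)\pmod 1$ on $\mathbb T^2=\mathbb R^2/\mathbb Z^2$, and $f_\omega^n:=f_{\omega_{n-1}}\circ\cdots\circ f_{\omega_0}$. Here $m$ is an integer. *)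

theory Defs
  imports "HOL-Probability.Probability"
begin

quotient_type torus = "real \<times> real" /
  "\<lambda>z w. fst z - fst w \<in> \<int> \<and> snd z - snd w \<in> \<int>"
  morphisms rep_torus torus_proj
proof (rule equivpI)
  let ?R = "\<lambda>z w :: real \<times> real. fst z - fst w \<in> \<int> \<and> snd z - snd w \<in> \<int>"
  show "reflp ?R" by (simp add: reflp_def)
  show "symp ?R"
    by (metis (no_types, lifting) Ints_minus minus_diff_eq sympI)
  show "transp ?R"
  proof (rule transpI)
    fix x y z :: "real \<times> real"
    assume "?R x y" "?R y z"
    then show "?R x z"
      using Ints_add[of "fst x - fst y" "fst y - fst z"] Ints_add[of "snd x - snd y" "snd y - snd z"]
      by auto
  qed
qed

text \<open>
  The tangent spaces of the torus are identified with the plane through the covering projection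
  \<^term>\<open>torus_proj\<close>. The derivative of a torus map \<open>g\<close> at \<open>p\<close> is the derivative of a lift \<open>G\<close> at
  a point \<open>z\<close> over \<open>p\<close>. Differentiability of \<open>G\<close> at \<open>z\<close> makes \<open>G\<close> continuous there, so two such
  lifts differ near \<open>z\<close> by a constant integer vector, and the derivative does not depend on the choice.
\<close>

definition torus_has_deriv ::
    "(torus \<Rightarrow> torus) \<Rightarrow> (real \<times> real \<Rightarrow> real \<times> real) \<Rightarrow> torus \<Rightarrow> bool" where
  "torus_has_deriv g A p \<longleftrightarrow>
     (\<exists>G z. torus_proj z = p \<and> (\<forall>w. g (torus_proj w) = torus_proj (G w)) \<and>
            (G has_derivative A) (at z))"

lemma torus_proj_eq_iff:
  "torus_proj z = torus_proj w \<longleftrightarrow> fst z - fst w \<in> \<int> \<and> snd z - snd w \<in> \<int>"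
  using torus.abs_eq_iff by simp

lemma torus_has_deriv_unique:
  assumes "torus_has_deriv g A p" "torus_has_deriv g B p"
  shows "A = B"
proof -
  obtain G z where G: "torus_proj z = p" "\<And>w. g (torus_proj w) = torus_proj (G w)"
    "(G has_derivative A) (at z)"
    using assms(1) unfolding torus_has_deriv_def by blast
  obtain H y where H: "torus_proj y = p" "\<And>w. g (torus_proj w) = torus_proj (H w)"
    "(H has_derivative B) (at y)"
    using assms(2) unfolding torus_has_deriv_def by blast
  define H' where "H' = (\<lambda>w. H (w + (y - z)))"
  define D where "D = (\<lambda>w. G w - H' w)"
  have yz: "fst (y - z) \<in> \<int>" "snd (y - z) \<in> \<int>"
    using G(1) H(1) torus_proj_eq_iff[of y z] by simp_all
  have Dint: "fst (D w) \<in> \<int>" "snd (D w) \<in> \<int>" for w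
  proof -
    have "torus_proj w = torus_proj (w + (y - z))"
      using yz by (metis torus_proj_eq_iff add_diff_cancel_left' fst_diff snd_diff)
    then have "torus_proj (G w) = torus_proj (H' w)"
      unfolding H'_def using G(2) H(2) by metis
    then show "fst (D w) \<in> \<int>" "snd (D w) \<in> \<int>"
      unfolding D_def torus_proj_eq_iff by simp_all
  qed
  have "(H' has_derivative B) (at z)"
  proof -
    have shift: "((\<lambda>w. w + (y - z)) has_derivative (\<lambda>h. h)) (at z)"
      by (auto intro!: derivative_eq_intros)
    have "(H has_derivative B) (at (z + (y - z)))" using H(3) by simp
    from has_derivative_compose[OF shift this] show ?thesis unfolding H'_def .
  qed
  with G(3) have D': "(D has_derivative (\<lambda>h. A h - B h)) (at z)"
    unfolding D_def by (rule has_derivative_diff)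
  have "isCont D z" using D' by (rule has_derivative_continuous)
  then have "\<forall>\<^sub>F w in nhds z. dist (D w) (D z) < 1"
    unfolding isCont_def tendsto_at_iff_tendsto_nhds by (rule tendstoD) simp
  moreover have "D w = D z" if "dist (D w) (D z) < 1" for w
  proof -
    have "\<bar>fst (D w) - fst (D z)\<bar> < 1" "\<bar>snd (D w) - snd (D z)\<bar> < 1"
      using that dist_fst_le[of "D w" "D z"] dist_snd_le[of "D w" "D z"]
      by (simp_all add: dist_real_def)
    then show ?thesis
      using Dint[of w] Dint[of z] by (metis Ints_eq_abs_less1 prod_eq_iff)
  qed
  ultimately have "\<forall>\<^sub>F w in nhds z. D w = D z" by (auto elim: eventually_mono)
  then have "(D has_derivative (\<lambda>h. 0)) (at z)"
    by (intro has_derivative_transform_eventually[OF has_derivative_const])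
       (auto simp: eventually_at_filter elim: eventually_mono)
  from has_derivative_unique[OF D' this] show ?thesis by (auto simp: fun_eq_iff)
qed

definition torus_deriv :: "(torus \<Rightarrow> torus) \<Rightarrow> torus \<Rightarrow> real \<times> real \<Rightarrow> real \<times> real" where
  "torus_deriv g p = (THE A. torus_has_deriv g A p)"

definition potential :: "real \<Rightarrow> real \<Rightarrow> real" where
  "potential L x = L * cos (2 * pi * x)"

lemma potential_cong:
  assumes "x - x' \<in> \<int>"
  shows "potential L x = potential L x'"
proof -
  from assms obtain k :: int where "x - x' = of_int k" by (auto elim: Ints_cases)
  then have "x = x' + of_int k" by simp
  then have "2 * pi * x = 2 * pi * x' + of_int k * (2 * pi)" by (simp add: algebra_simps)
  then show ?thesis
    unfolding potential_def
    by (simp add: cos_add mult.commute[of "real_of_int k"])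
qed

lift_definition step_map :: "real \<Rightarrow> real \<Rightarrow> torus \<Rightarrow> torus" is
  "\<lambda>L t (x, y). (potential L (x + t) - y, x + t)"
proof -
  fix L t :: real and z w :: "real \<times> real"
  assume *: "fst z - fst w \<in> \<int> \<and> snd z - snd w \<in> \<int>"
  have "potential L (fst z + t) = potential L (fst w + t)"
    using * by (intro potential_cong) simp
  moreover have "snd w - snd z \<in> \<int>"
    using * by (metis Ints_minus minus_diff_eq)
  ultimately show "fst (case z of (x, y) \<Rightarrow> (potential L (x + t) - y, x + t)) -
          fst (case w of (x, y) \<Rightarrow> (potential L (x + t) - y, x + t)) \<in> \<int> \<and>
        snd (case z of (x, y) \<Rightarrow> (potential L (x + t) - y, x + t)) -
          snd (case w of (x, y) \<Rightarrow> (potential L (x + t) - y, x + t)) \<in> \<int>"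
    using * by (simp add: case_prod_beta)
qed

primrec random_iter :: "real \<Rightarrow> (nat \<Rightarrow> real) \<Rightarrow> nat \<Rightarrow> torus \<Rightarrow> torus" where
  "random_iter L \<omega> 0 = id"
| "random_iter L \<omega> (Suc n) = step_map L (\<omega> n) \<circ> random_iter L \<omega> n"

definition noise_law :: "real \<Rightarrow> real measure" where
  "noise_law \<sigma> = uniform_measure (restrict_space lborel {-\<sigma>..\<sigma>}) {-\<sigma>..\<sigma>}"

definition noise_space :: "real \<Rightarrow> real \<Rightarrow> (nat \<Rightarrow> real) measure" where
  "noise_space L \<delta> = (\<Pi>\<^sub>M n\<in>UNIV. noise_law (L powr (-\<delta>)))"

end

theory Submission
  imports Defs "HOL-Real_Asymp.Real_Asymp"
begin

text \<open>
  Put \<open>r = 1/200\<close>. It suffices to show \<open>E |Df^3 v|^(-r) \<le> L^(-24r/25) |v|^(-r)\<close> uniformly in the base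
  point and in \<open>v\<close>: since the noise is i.i.d., this iterates to \<open>L^(-24rm/25)\<close> after \<open>3m\<close> steps, and
  Markov's inequality gives the claim with \<open>r1 = (24/25 - \<alpha>) r\<close> and \<open>r2 = r\<close>.

  One step sends \<open>(v1, v2)\<close> to \<open>(a v1 - v2, v1)\<close> with \<open>a = -2\<pi>L sin (2\<pi>(x + t))\<close>. Whatever \<open>v\<close> is, the noise
  \<open>t\<close> violates \<open>|a v1 - v2| \<ge> L^(4/5) |v1|\<close> with probability at most
  \<open>8 L^(-1/10) L^\<delta> \<le> 8 L^(-1/20)\<close>; the square root lost at a quadratic tangency is affordable because
  \<open>\<delta> \<le> 1/100\<close>. If the inequality holds in three consecutive steps, then the first of them yields a
  first component of size at least \<open>L^(-1/5) |v| / 10\<close> and the next two multiply it by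
  \<open>L^(4/5)\<close> each, so the norm grows by \<open>L^(7/5) / 10 \<ge> L\<close>. Otherwise it shrinks at most by
  \<open>(10 L)^3\<close>, which the smallness of \<open>r\<close> outweighs.
\<close>

section \<open>Measure of the noise values at which a sine is close to a given level\<close>

text \<open>For \<open>x = pi * s\<close> the cubic Taylor remainder is at most
  \<open>2/3 * \<bar>x\<bar>\<close>, since \<open>x^2 \<le> 4\<close>. This leaves
  \<open>\<bar>x\<bar> / 3\<close>, which dominates \<open>\<bar>s\<bar>\<close> because
  \<open>pi \<ge> 3\<close>.\<close>

lemma abs_sin_pi_ge:
  fixes s :: real
  assumes "\<bar>s\<bar> \<le> 1/2"
  shows "\<bar>s\<bar> \<le> \<bar>sin (pi * s)\<bar>"
proof -
  define x where "x = pi * s"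
  have pi: "3 \<le> pi" "pi \<le> 22/7"
    using pi_approx by simp_all
  have "\<bar>sin x - (\<Sum>m<3. sin_coeff m * x ^ m)\<bar> \<le> inverse (fact 3) * \<bar>x\<bar> ^ 3"
    by (rule Maclaurin_sin_bound)
  then have sin: "\<bar>sin x - x\<bar> \<le> \<bar>x\<bar> ^ 3 / 6"
    by (simp add: eval_nat_numeral sin_coeff_def field_simps)
  have x: "\<bar>x\<bar> = pi * \<bar>s\<bar>"
    by (simp add: x_def abs_mult)
  have "\<bar>x\<bar> \<le> 22/7 * (1/2)"
    unfolding x by (rule mult_mono) (use assms pi in auto)
  then have "\<bar>x\<bar> ^ 2 \<le> (22/7 * (1/2)) ^ 2"
    by (rule power_mono) simp
  then have "\<bar>x\<bar> * \<bar>x\<bar> ^ 2 \<le> \<bar>x\<bar> * 4"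
    by (intro mult_left_mono) (simp_all add: power2_eq_square)
  then have "\<bar>x\<bar> ^ 3 \<le> 4 * \<bar>x\<bar>"
    by (simp add: eval_nat_numeral algebra_simps)
  with sin have "\<bar>x\<bar> / 3 \<le> \<bar>sin x\<bar>"
    by arith
  moreover have "\<bar>s\<bar> \<le> \<bar>x\<bar> / 3"
    unfolding x using mult_right_mono[OF pi(1), of "\<bar>s\<bar>"] by simp
  ultimately show ?thesis
    unfolding x_def by linarith
qed

lemma abs_sin_add_of_int_pi: "\<bar>sin (x + pi * of_int k)\<bar> = \<bar>sin x\<bar>"
proof -
  have "cos (pi * of_int k) = 1 \<or> cos (pi * of_int k) = - 1"
    using sin_cos_squared_add[of "pi * of_int k"] by (simp add: power2_eq_1_iff)
  then show ?thesis
    by (auto simp: sin_add)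
qed

text \<open>The sublevel set lies within distance \<open>\<eta>\<close> of the zeros
  \<open>k - c\<close> of the sine, by \<open>abs_sin_pi_ge\<close> after rounding
  \<open>t + c\<close>. Four zeros suffice, each contributing an interval of length
  \<open>2 * \<eta>\<close>.\<close>

lemma emeasure_abs_sin_le:
  fixes c \<eta> \<sigma> :: real
  assumes "\<sigma> \<le> 1" "0 \<le> \<eta>"
  shows "emeasure lborel {t \<in> {-\<sigma>..\<sigma>}. \<bar>sin (pi * (t + c))\<bar> \<le> \<eta>} \<le> ennreal (8 * \<eta>)"
proof -
  \<comment> \<open>As \<open>\<bar>t\<bar> \<le> 1\<close> and rounding moves by at most 1/2, the
    integer nearest to \<open>t + c\<close> is within 3/2 of \<open>c\<close>, so it is one of these
    four.\<close>
  define K where "K = {\<lfloor>c\<rfloor> - 1..\<lfloor>c\<rfloor> + 2}"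
  define I where "I = (\<lambda>k::int. {of_int k - c - \<eta>..of_int k - c + \<eta>})"
  have "{t \<in> {-\<sigma>..\<sigma>}. \<bar>sin (pi * (t + c))\<bar> \<le> \<eta>} \<subseteq> (\<Union>k\<in>K. I k)"
  proof
    fix t assume "t \<in> {t \<in> {-\<sigma>..\<sigma>}. \<bar>sin (pi * (t + c))\<bar> \<le> \<eta>}"
    then have t: "\<bar>t\<bar> \<le> 1" "\<bar>sin (pi * (t + c))\<bar> \<le> \<eta>"
      using assms by auto
    define k where "k = round (t + c)"
    have k: "\<bar>t + c - of_int k\<bar> \<le> 1/2"
      unfolding k_def using of_int_round_abs_le[of "t + c"] by (simp add: abs_minus_commute)
    have "\<bar>t + c - of_int k\<bar> \<le> \<bar>sin (pi * (t + c - of_int k))\<bar>"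
      by (rule abs_sin_pi_ge) fact
    also have "\<dots> = \<bar>sin (pi * (t + c - of_int k) + pi * of_int k)\<bar>"
      by (simp only: abs_sin_add_of_int_pi)
    also have "\<dots> \<le> \<eta>"
      using t(2) by (simp add: algebra_simps)
    finally have "t \<in> I k"
      unfolding I_def by (auto simp: abs_le_iff)
    moreover have "k \<in> K"
    proof -
      have "real_of_int (\<lfloor>c\<rfloor> - 2) < of_int k" "real_of_int k < of_int (\<lfloor>c\<rfloor> + 3)"
        using k t(1) floor_correct[of c] unfolding abs_le_iff by linarith+
      then show ?thesis
        unfolding K_def of_int_less_iff by simp
    qed
    ultimately show "t \<in> (\<Union>k\<in>K. I k)" by blast
  qed
  then have "emeasure lborel {t \<in> {-\<sigma>..\<sigma>}. \<bar>sin (pi * (t + c))\<bar> \<le> \<eta>} \<le> emeasure lborel (\<Union>k\<in>K. I k)"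
    by (rule emeasure_mono) (simp add: I_def)
  also have "\<dots> \<le> (\<Sum>k\<in>K. emeasure lborel (I k))"
    by (rule emeasure_subadditive_finite) (auto simp: K_def I_def)
  also have "\<dots> = (\<Sum>k\<in>K. ennreal (2 * \<eta>))"
    by (rule sum.cong) (use assms in \<open>auto simp: I_def\<close>)
  also have "\<dots> = ennreal (8 * \<eta>)"
    using assms by (simp add: K_def ennreal_mult ennreal_numeral flip: mult.assoc)
  finally show ?thesis .
qed

text \<open>
  Comparing with one chosen element \<open>s\<close> of the set, the product formula for \<open>sin u - sin w\<close> shows
  that one of its two factors is at most \<open>sqrt \<epsilon>\<close>. This avoids a separate treatment of the
  tangency at \<open>B = \<plusminus>1\<close>.
\<close>

lemma emeasure_abs_sin_diff_le:
  fixes x B \<epsilon> \<sigma> :: real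
  assumes "\<sigma> \<le> 1" "0 \<le> \<epsilon>"
  shows "emeasure lborel {t \<in> {-\<sigma>..\<sigma>}. \<bar>sin (2 * pi * (x + t)) - B\<bar> \<le> \<epsilon>} \<le> ennreal (16 * sqrt \<epsilon>)"
    (is "emeasure _ ?S \<le> _")
proof (cases "?S = {}")
  case False
  then obtain s where s: "\<bar>sin (2 * pi * (x + s)) - B\<bar> \<le> \<epsilon>" by blast
  let ?T = "\<lambda>c. {t \<in> {-\<sigma>..\<sigma>}. \<bar>sin (pi * (t + c))\<bar> \<le> sqrt \<epsilon>}"
  have "?S \<subseteq> ?T (- s) \<union> ?T (2 * x + s + 1/2)"
  proof
    fix t assume t: "t \<in> ?S"
    let ?a = "sin (pi * (t + - s))" and ?b = "sin (pi * (t + (2 * x + s + 1/2)))"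
    \<comment> \<open>The shift by 1/2 turns the cosine of the product formula into a sine, so
      \<open>emeasure_abs_sin_le\<close> covers both factors.\<close>
    have b: "?b = cos (pi * (2 * x + t + s))"
      using sin_add[of "pi * (2 * x + t + s)" "pi / 2"] by (simp add: algebra_simps)
    have "sin (2 * pi * (x + t)) - sin (2 * pi * (x + s)) = 2 * ?a * ?b"
      unfolding b sin_diff_sin by (simp add: algebra_simps diff_divide_distrib add_divide_distrib)
    then have "2 * (\<bar>?a\<bar> * \<bar>?b\<bar>) \<le> 2 * \<epsilon>"
      using s t by (simp add: abs_mult[symmetric]) arith
    then have ab: "\<bar>?a\<bar> * \<bar>?b\<bar> \<le> sqrt \<epsilon> * sqrt \<epsilon>"
      using assms by simp
    have "\<bar>?a\<bar> \<le> sqrt \<epsilon> \<or> \<bar>?b\<bar> \<le> sqrt \<epsilon>"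
    proof (rule ccontr)
      assume "\<not> ?thesis"
      then have "sqrt \<epsilon> * sqrt \<epsilon> < \<bar>?a\<bar> * \<bar>?b\<bar>"
        using assms by (intro mult_strict_mono') auto
      with ab show False by simp
    qed
    with t show "t \<in> ?T (- s) \<union> ?T (2 * x + s + 1/2)" by blast
  qed
  then have "emeasure lborel ?S \<le> emeasure lborel (?T (- s) \<union> ?T (2 * x + s + 1/2))"
    by (rule emeasure_mono) measurable
  also have "\<dots> \<le> emeasure lborel (?T (- s)) + emeasure lborel (?T (2 * x + s + 1/2))"
    by (rule emeasure_subadditive) measurable
  also have "\<dots> \<le> ennreal (8 * sqrt \<epsilon>) + ennreal (8 * sqrt \<epsilon>)"
    using assms by (intro add_mono emeasure_abs_sin_le) simp_all
  also have "\<dots> = ennreal (16 * sqrt \<epsilon>)"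
    using assms by (simp flip: ennreal_plus)
  finally show ?thesis .
next
  case True
  then show ?thesis by (simp only: emeasure_empty zero_le)
qed

section \<open>Lift to the plane and the derivative cocycle\<close>

definition lift_step :: "real \<Rightarrow> real \<Rightarrow> real \<times> real \<Rightarrow> real \<times> real" where
  "lift_step L t z = (potential L (fst z + t) - snd z, fst z + t)"

definition tangent_step :: "real \<Rightarrow> real \<Rightarrow> real \<times> real \<Rightarrow> real \<times> real \<Rightarrow> real \<times> real" where
  "tangent_step L t z v = (- (2 * pi * L * sin (2 * pi * (fst z + t))) * fst v - snd v, fst v)"

primrec lift_iter :: "real \<Rightarrow> (nat \<Rightarrow> real) \<Rightarrow> nat \<Rightarrow> real \<times> real \<Rightarrow> real \<times> real" where
  "lift_iter L \<omega> 0 z = z"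
| "lift_iter L \<omega> (Suc n) z = lift_step L (\<omega> n) (lift_iter L \<omega> n z)"

primrec tangent_iter ::
    "real \<Rightarrow> (nat \<Rightarrow> real) \<Rightarrow> nat \<Rightarrow> real \<times> real \<Rightarrow> real \<times> real \<Rightarrow> real \<times> real" where
  "tangent_iter L \<omega> 0 z v = v"
| "tangent_iter L \<omega> (Suc n) z v =
     tangent_step L (\<omega> n) (lift_iter L \<omega> n z) (tangent_iter L \<omega> n z v)"

lemma lift_step_has_derivative:
  "(lift_step L t has_derivative tangent_step L t z) (at z)"
  unfolding lift_step_def[abs_def] tangent_step_def[abs_def] potential_def
  by (auto intro!: derivative_eq_intros simp: fun_eq_iff algebra_simps)

lemma lift_iter_has_derivative:
  "(lift_iter L \<omega> n has_derivative tangent_iter L \<omega> n z) (at z)"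
proof (induction n)
  case 0
  show ?case by (simp add: lift_iter.simps(1)[abs_def] tangent_iter.simps(1)[abs_def])
next
  case (Suc n)
  from has_derivative_compose[OF Suc lift_step_has_derivative]
  show ?case by (simp add: lift_iter.simps(2)[abs_def] tangent_iter.simps(2)[abs_def])
qed

lemma random_iter_torus_proj: "random_iter L \<omega> n (torus_proj z) = torus_proj (lift_iter L \<omega> n z)"
proof (induction n)
  case (Suc n)
  then show ?case
    by (simp add: step_map.abs_eq lift_step_def case_prod_beta)
qed simp

text \<open>\<open>lift_iter\<close> is the lift that witnesses differentiability, and
  \<open>torus_has_deriv_unique\<close> makes the definite description in \<open>torus_deriv\<close>
  denote its derivative. From here on only explicit planar recursions occur.\<close>

lemma torus_deriv_random_iter:
  "torus_deriv (random_iter L \<omega> n) (torus_proj z) = tangent_iter L \<omega> n z"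
proof -
  have *: "torus_has_deriv (random_iter L \<omega> n) (tangent_iter L \<omega> n z) (torus_proj z)"
    unfolding torus_has_deriv_def using random_iter_torus_proj lift_iter_has_derivative by blast
  show ?thesis
    unfolding torus_deriv_def
    by (rule the_equality) (use * torus_has_deriv_unique in blast)+
qed

text \<open>The recursion splits off the last noise value, whereas conditioning on the first one
  needs the opposite splitting; \<open>case_nat t \<omega>\<close> prepends \<open>t\<close> to
  \<open>\<omega>\<close>.\<close>

lemma lift_iter_case_nat:
  "lift_iter L (case_nat t \<omega>) (Suc n) z = lift_iter L \<omega> n (lift_step L t z)"
  by (induction n) simp_all

lemma tangent_iter_case_nat:
  "tangent_iter L (case_nat t \<omega>) (Suc n) z v =
     tangent_iter L \<omega> n (lift_step L t z) (tangent_step L t z v)"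
proof (induction n)
  case (Suc n)
  have "tangent_iter L (case_nat t \<omega>) (Suc (Suc n)) z v =
      tangent_step L (\<omega> n) (lift_iter L (case_nat t \<omega>) (Suc n) z)
        (tangent_iter L (case_nat t \<omega>) (Suc n) z v)"
    by simp
  then show ?case
    unfolding Suc lift_iter_case_nat by simp
qed simp

section \<open>Deterministic bounds for one and three tangent steps\<close>

lemma norm_pair_le_abs: "norm v \<le> \<bar>fst v\<bar> + \<bar>snd v\<bar>" for v :: "real \<times> real"
  using norm_Pair_le[of "fst v" "snd v"] by simp

text \<open>Solving for \<open>v\<close> in terms of its image \<open>w\<close> gives
  \<open>fst v = snd w\<close> and \<open>snd v = - a * snd w - fst w\<close> with
  \<open>\<bar>a\<bar> \<le> 8 * L\<close>, so the inverse has norm at most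
  \<open>8 * L + 2\<close>.\<close>

lemma norm_tangent_step_ge:
  assumes "1 \<le> L"
  shows "norm v \<le> 10 * L * norm (tangent_step L t z v)"
proof -
  define w where "w = tangent_step L t z v"
  define a where "a = 2 * pi * L * sin (2 * pi * (fst z + t))"
  have w: "fst w = - a * fst v - snd v" "snd w = fst v"
    by (simp_all add: w_def a_def tangent_step_def)
  have W: "\<bar>fst w\<bar> \<le> norm w" "\<bar>snd w\<bar> \<le> norm w"
    using norm_fst_le[of "fst w" "snd w"] norm_snd_le[of "snd w" "fst w"] by simp_all
  have "\<bar>a\<bar> \<le> 2 * pi * L * 1"
    unfolding a_def abs_mult using assms by (intro mult_mono) auto
  moreover have "pi * L \<le> 4 * L"
    using assms pi_less_4 by (intro mult_right_mono) auto
  ultimately have a: "\<bar>a\<bar> \<le> 8 * L" by linarith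
  have "norm v \<le> \<bar>fst v\<bar> + \<bar>snd v\<bar>"
    by (rule norm_pair_le_abs)
  also have "\<dots> \<le> \<bar>snd w\<bar> + (\<bar>a\<bar> * \<bar>snd w\<bar> + \<bar>fst w\<bar>)"
    using w abs_mult[of a "fst v"] by simp
  also have "\<dots> \<le> norm w + (8 * L * norm w + norm w)"
    using W a by (intro add_mono mult_mono) auto
  also have "\<dots> \<le> 10 * L * norm w"
    using mult_right_mono[OF assms, of "norm w"] by (simp add: algebra_simps)
  finally show ?thesis unfolding w_def .
qed

text \<open>The strict inequality leaves this set empty when \<open>fst v = 0\<close>. Counting such
  a vertical vector as good is harmless: the step makes it horizontal without changing its
  norm.\<close>

definition bad_noise :: "real \<Rightarrow> real \<times> real \<Rightarrow> real \<times> real \<Rightarrow> real set" where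
  "bad_noise L z v = {t. \<bar>fst (tangent_step L t z v)\<bar> < L powr (4/5) * \<bar>fst v\<bar>}"

text \<open>If \<open>fst v\<close> is not too small compared with \<open>norm v\<close>, goodness
  of \<open>t\<close> gives the bound at once. Otherwise \<open>v\<close> is nearly vertical and
  \<open>snd v\<close> dominates whatever the noise: \<open>9/10 - 44/70\<close> exceeds
  \<open>1/10\<close>.\<close>

lemma fst_tangent_step_ge_norm:
  assumes "1 \<le> L" "t \<notin> bad_noise L z v"
  shows "L powr (-1/5) / 10 * norm v \<le> \<bar>fst (tangent_step L t z v)\<bar>"
proof (cases "norm v \<le> 10 * L * \<bar>fst v\<bar>")
  case True
  have L: "L powr (-1/5) * L = L powr (4/5)"
    using assms powr_add[of L "-1/5" 1] by simp
  have "L powr (-1/5) / 10 * norm v \<le> L powr (-1/5) / 10 * (10 * L * \<bar>fst v\<bar>)"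
    using True by (intro mult_left_mono) auto
  also have "\<dots> = L powr (4/5) * \<bar>fst v\<bar>"
    unfolding L[symmetric] by simp
  also have "\<dots> \<le> \<bar>fst (tangent_step L t z v)\<bar>"
    using assms(2) by (simp add: bad_noise_def)
  finally show ?thesis .
next
  case False
  define a where "a = 2 * pi * L * sin (2 * pi * (fst z + t))"
  have "\<bar>a\<bar> \<le> 2 * pi * L * 1"
    unfolding a_def abs_mult using assms by (intro mult_mono) auto
  moreover have "pi * L \<le> 22/7 * L"
    using assms pi_approx by (intro mult_right_mono) auto
  ultimately have "\<bar>a\<bar> \<le> 44/7 * L" by linarith
  then have "\<bar>a\<bar> * \<bar>fst v\<bar> \<le> 44/7 * L * \<bar>fst v\<bar>"
    by (intro mult_right_mono) auto
  then have a: "\<bar>a * fst v\<bar> \<le> 44/70 * norm v"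
    using False by (simp add: abs_mult)
  have "1 * \<bar>fst v\<bar> \<le> L * \<bar>fst v\<bar>"
    using assms by (intro mult_right_mono) auto
  with False have "\<bar>fst v\<bar> \<le> norm v / 10" by simp
  then have "9/10 * norm v \<le> \<bar>snd v\<bar>"
    using norm_pair_le_abs[of v] by simp
  moreover have "\<bar>snd v\<bar> - \<bar>a * fst v\<bar> \<le> \<bar>- a * fst v - snd v\<bar>"
    by simp
  ultimately have "norm v / 10 \<le> \<bar>- a * fst v - snd v\<bar>"
    using a norm_ge_zero[of v] by linarith
  moreover have "L powr (-1/5) \<le> 1"
    using powr_mono[of "-1/5" 0 L] assms by simp
  then have "L powr (-1/5) / 10 * norm v \<le> 1 / 10 * norm v"
    by (intro mult_right_mono) auto
  ultimately show ?thesis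
    by (simp add: tangent_step_def a_def)
qed

text \<open>Since \<open>4/5 + 4/5 - 1/5 = 1 + 2/5\<close>, the surplus \<open>L powr (2/5)\<close>
  pays for the factor 1/10 of the first step. Only the vectors are chained; the base points are
  arbitrary.\<close>

lemma norm_tangent_three_steps_ge:
  assumes "1 \<le> L" "10 \<le> L powr (2/5)"
    and "t0 \<notin> bad_noise L z0 v0"
    and "v1 = tangent_step L t0 z0 v0" "t1 \<notin> bad_noise L z1 v1"
    and "v2 = tangent_step L t1 z1 v1" "t2 \<notin> bad_noise L z2 v2"
    and "v3 = tangent_step L t2 z2 v2"
  shows "L * norm v0 \<le> norm v3"
proof -
  have L: "L * L powr (2/5) = L powr (4/5) * L powr (4/5) * L powr (-1/5)"
    using assms powr_add[of L 1 "2/5"] by (simp flip: powr_add)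
  have "L * norm v0 \<le> L * (L powr (2/5) / 10) * norm v0"
    using assms by (intro mult_right_mono) auto
  also have "\<dots> = L * L powr (2/5) * (norm v0 / 10)"
    by simp
  also have "\<dots> = L powr (4/5) * (L powr (4/5) * (L powr (-1/5) / 10 * norm v0))"
    unfolding L by simp
  also have "\<dots> \<le> L powr (4/5) * (L powr (4/5) * \<bar>fst v1\<bar>)"
    unfolding assms(4) by (intro mult_left_mono fst_tangent_step_ge_norm assms) auto
  also have "\<dots> \<le> L powr (4/5) * \<bar>fst v2\<bar>"
    using assms(5,6) by (intro mult_left_mono) (auto simp: bad_noise_def)
  also have "\<dots> \<le> \<bar>fst v3\<bar>"
    using assms(7,8) by (auto simp: bad_noise_def)
  also have "\<dots> \<le> norm v3"
    using norm_fst_le[of "fst v3" "snd v3"] by simp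
  finally show ?thesis .
qed

section \<open>The noise law, splitting off one coordinate, and measurability\<close>

lemma space_noise_law: "space (noise_law \<sigma>) = {-\<sigma>..\<sigma>}"
  by (simp add: noise_law_def space_restrict_space)

lemma prob_space_noise_law:
  assumes "0 < \<sigma>"
  shows "prob_space (noise_law \<sigma>)"
  unfolding noise_law_def using assms
  by (intro prob_space_uniform_measure) (simp_all add: emeasure_restrict_space)

lemma borel_measurable_noise_law:
  assumes "f \<in> borel_measurable borel"
  shows "f \<in> borel_measurable (noise_law \<sigma>)"
proof -
  have "f \<in> borel_measurable (restrict_space lborel {-\<sigma>..\<sigma>})"
    by (rule measurable_restrict_space1) (use assms in simp)
  then show ?thesis
    by (simp add: noise_law_def cong: measurable_cong_sets)
qed

lemma emeasure_noise_law:
  assumes "0 < \<sigma>" "B \<in> sets borel"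
  shows "emeasure (noise_law \<sigma>) (B \<inter> {-\<sigma>..\<sigma>}) = emeasure lborel (B \<inter> {-\<sigma>..\<sigma>}) / ennreal (2 * \<sigma>)"
proof -
  have "B \<inter> {-\<sigma>..\<sigma>} \<in> sets (restrict_space lborel {-\<sigma>..\<sigma>})"
    using assms by (simp add: sets_restrict_space_iff)
  then show ?thesis
    unfolding noise_law_def using assms
    by (subst emeasure_uniform_measure)
       (simp_all add: emeasure_restrict_space sets_restrict_space_iff inf.absorb2)
qed

text \<open>The majorant is \<open>a\<close> off \<open>B\<close> and \<open>a + d\<close> on
  \<open>B\<close>, and \<open>B\<close> has probability at most \<open>p\<close>. Monotonicity of
  the integral holds for arbitrary \<open>g\<close>, so \<open>g\<close> can be an inner integral
  over the remaining noise.\<close>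

lemma nn_integral_noise_law_le:
  assumes "0 < \<sigma>" "0 \<le> a" "0 \<le> d" "0 \<le> p" "B \<in> sets borel"
    and B: "emeasure lborel (B \<inter> {-\<sigma>..\<sigma>}) \<le> ennreal (2 * \<sigma> * p)"
    and g: "\<And>t. t \<in> {-\<sigma>..\<sigma>} \<Longrightarrow> g t \<le> ennreal (a + d * indicator B t)"
  shows "(\<integral>\<^sup>+t. g t \<partial>noise_law \<sigma>) \<le> ennreal (a + d * p)"
proof -
  interpret prob_space "noise_law \<sigma>"
    by (rule prob_space_noise_law) fact
  have B': "B \<inter> {-\<sigma>..\<sigma>} \<in> sets (noise_law \<sigma>)"
    using assms by (simp add: noise_law_def sets_restrict_space_iff)
  have "(\<integral>\<^sup>+t. g t \<partial>noise_law \<sigma>) \<le>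
      (\<integral>\<^sup>+t. ennreal a + ennreal d * indicator (B \<inter> {-\<sigma>..\<sigma>}) t \<partial>noise_law \<sigma>)"
  proof (rule nn_integral_mono)
    fix t assume "t \<in> space (noise_law \<sigma>)"
    then have t: "t \<in> {-\<sigma>..\<sigma>}" by (simp add: space_noise_law)
    then have "ennreal (a + d * indicator B t) = ennreal a + ennreal d * indicator (B \<inter> {-\<sigma>..\<sigma>}) t"
      using assms by (auto simp: indicator_def)
    with g[OF t] show "g t \<le> ennreal a + ennreal d * indicator (B \<inter> {-\<sigma>..\<sigma>}) t" by simp
  qed
  also have "\<dots> = ennreal a + ennreal d * emeasure (noise_law \<sigma>) (B \<inter> {-\<sigma>..\<sigma>})"
    using B' by (simp add: nn_integral_add nn_integral_cmult emeasure_space_1)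
  also have "emeasure (noise_law \<sigma>) (B \<inter> {-\<sigma>..\<sigma>}) \<le> ennreal (2 * \<sigma> * p) / ennreal (2 * \<sigma>)"
    unfolding emeasure_noise_law[OF assms(1,5)] by (rule divide_right_mono_ennreal) fact
  also have "\<dots> = ennreal p"
    using assms by (simp add: divide_ennreal)
  also have "ennreal a + ennreal d * ennreal p = ennreal (a + d * p)"
    using assms by (simp add: ennreal_mult)
  finally show ?thesis
    by (simp add: add_left_mono mult_left_mono)
qed

lemma tangent_step_nonzero:
  assumes "1 \<le> L" "v \<noteq> 0"
  shows "tangent_step L t z v \<noteq> 0"
  using norm_tangent_step_ge[OF assms(1), of v t z] assms(2) by auto

lemma sequence_space_noise_law:
  assumes "0 < L"
  shows "sequence_space (noise_law (L powr - \<delta>))"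
proof -
  interpret prob_space "noise_law (L powr - \<delta>)"
    using assms by (intro prob_space_noise_law) simp
  show ?thesis by unfold_locales
qed

text \<open>Prepending an independent coordinate to an i.i.d. sequence reproduces its law
  (\<open>PiM_iter\<close>); the iterated integral is then Fubini.\<close>

lemma nn_integral_noise_space_case_nat:
  assumes "0 < L" and [measurable]: "F \<in> borel_measurable (noise_space L \<delta>)"
  shows "(\<integral>\<^sup>+\<omega>. F \<omega> \<partial>noise_space L \<delta>) =
    (\<integral>\<^sup>+t. \<integral>\<^sup>+\<omega>. F (case_nat t \<omega>) \<partial>noise_space L \<delta> \<partial>noise_law (L powr - \<delta>))"
proof -
  interpret sequence_space "noise_law (L powr - \<delta>)"
    using assms(1) by (rule sequence_space_noise_law)
  have m[measurable]: "F \<in> borel_measurable S"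
    using assms(2) by (simp add: noise_space_def)
  have "(\<integral>\<^sup>+\<omega>. F \<omega> \<partial>S) = (\<integral>\<^sup>+\<omega>. F \<omega> \<partial>distr (noise_law (L powr - \<delta>) \<Otimes>\<^sub>M S) S (\<lambda>(t, \<omega>). case_nat t \<omega>))"
    by (simp only: PiM_iter)
  also have "\<dots> = (\<integral>\<^sup>+x. F (case x of (t, \<omega>) \<Rightarrow> case_nat t \<omega>) \<partial>(noise_law (L powr - \<delta>) \<Otimes>\<^sub>M S))"
    by (rule nn_integral_distr) measurable
  also have "\<dots> = (\<integral>\<^sup>+t. \<integral>\<^sup>+\<omega>. F (case_nat t \<omega>) \<partial>S \<partial>noise_law (L powr - \<delta>))"
    by (subst nn_integral_fst[symmetric]) simp_all
  finally show ?thesis by (simp add: noise_space_def)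
qed

lemma borel_measurable_noise_coordinate:
  "(\<lambda>\<omega>. \<omega> n) \<in> borel_measurable (noise_space L \<delta>)"
proof -
  have "(\<lambda>\<omega>. \<omega> n) \<in> noise_space L \<delta> \<rightarrow>\<^sub>M noise_law (L powr - \<delta>)"
    unfolding noise_space_def by (rule measurable_component_singleton) simp
  from measurable_compose[OF this borel_measurable_noise_law[of "\<lambda>t. t"]] show ?thesis by simp
qed

lemma borel_measurable_lift_iter:
  "(\<lambda>\<omega>. fst (lift_iter L \<omega> n z)) \<in> borel_measurable (noise_space L \<delta>) \<and>
   (\<lambda>\<omega>. snd (lift_iter L \<omega> n z)) \<in> borel_measurable (noise_space L \<delta>)"
proof (induction n)
  case (Suc n)
  then have [measurable]: "(\<lambda>\<omega>. fst (lift_iter L \<omega> n z)) \<in> borel_measurable (noise_space L \<delta>)"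
    "(\<lambda>\<omega>. snd (lift_iter L \<omega> n z)) \<in> borel_measurable (noise_space L \<delta>)"
    by simp_all
  note [measurable] = borel_measurable_noise_coordinate
  show ?case by (simp add: lift_step_def potential_def)
qed simp

lemma borel_measurable_tangent_iter:
  "(\<lambda>\<omega>. fst (tangent_iter L \<omega> n z v)) \<in> borel_measurable (noise_space L \<delta>) \<and>
   (\<lambda>\<omega>. snd (tangent_iter L \<omega> n z v)) \<in> borel_measurable (noise_space L \<delta>)"
proof (induction n)
  case (Suc n)
  then have [measurable]: "(\<lambda>\<omega>. fst (tangent_iter L \<omega> n z v)) \<in> borel_measurable (noise_space L \<delta>)"
    "(\<lambda>\<omega>. snd (tangent_iter L \<omega> n z v)) \<in> borel_measurable (noise_space L \<delta>)"
    by simp_all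
  have [measurable]: "(\<lambda>\<omega>. fst (lift_iter L \<omega> n z)) \<in> borel_measurable (noise_space L \<delta>)"
    using borel_measurable_lift_iter by blast
  note [measurable] = borel_measurable_noise_coordinate
  show ?case by (simp add: tangent_step_def)
qed simp

lemma borel_measurable_norm_tangent_iter:
  "(\<lambda>\<omega>. norm (tangent_iter L \<omega> n z v)) \<in> borel_measurable (noise_space L \<delta>)"
proof -
  have [measurable]: "(\<lambda>\<omega>. fst (tangent_iter L \<omega> n z v)) \<in> borel_measurable (noise_space L \<delta>)"
    "(\<lambda>\<omega>. snd (tangent_iter L \<omega> n z v)) \<in> borel_measurable (noise_space L \<delta>)"
    using borel_measurable_tangent_iter by blast+
  show ?thesis unfolding norm_prod_def by measurable
qed

section \<open>Probability of bad noise\<close>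

lemma bad_noise_measurable: "bad_noise L z v \<in> sets borel"
  unfolding bad_noise_def tangent_step_def fst_conv by measurable

text \<open>Dividing the defining inequality by \<open>2 * pi * L * fst v\<close> says that the sine
  is within \<open>L powr (-1/5)\<close> of a fixed level, so
  \<open>emeasure_abs_sin_diff_le\<close> applies. The factor \<open>2 * L powr - \<delta>\<close>
  is the length of the noise interval.\<close>

lemma emeasure_bad_noise_le:
  assumes "1 \<le> L" "0 < \<delta>" "\<delta> \<le> 1/100"
  shows "emeasure lborel (bad_noise L z v \<inter> {- (L powr - \<delta>)..L powr - \<delta>})
    \<le> ennreal (2 * L powr - \<delta> * (8 * L powr (-1/20)))"
proof (cases "fst v = 0")
  case True
  then have "bad_noise L z v = {}" by (simp add: bad_noise_def)
  then show ?thesis by (simp only: Int_empty_left emeasure_empty zero_le)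
next
  case False
  define \<sigma> where "\<sigma> = L powr - \<delta>"
  define k where "k = 2 * pi * L * fst v"
  \<comment> \<open>The value of the sine at which the first component of the image vanishes; it may
    lie outside [-1, 1].\<close>
  define B where "B = - snd v / k"
  have kB: "k * B = - snd v"
    using False assms by (simp add: B_def k_def)
  have "1 * (L * \<bar>fst v\<bar>) \<le> (2 * pi) * (L * \<bar>fst v\<bar>)"
    using assms pi_ge_two by (intro mult_right_mono) auto
  then have k: "L * \<bar>fst v\<bar> \<le> \<bar>k\<bar>"
    using assms by (simp add: k_def abs_mult)
  have \<sigma>: "\<sigma> \<le> 1"
    unfolding \<sigma>_def using powr_mono[of "-\<delta>" 0 L] assms by simp
  have "bad_noise L z v \<inter> {-\<sigma>..\<sigma>} \<subseteq>
      {t \<in> {-\<sigma>..\<sigma>}. \<bar>sin (2 * pi * (fst z + t)) - B\<bar> \<le> L powr (-1/5)}"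
  proof
    fix t assume t: "t \<in> bad_noise L z v \<inter> {-\<sigma>..\<sigma>}"
    let ?s = "sin (2 * pi * (fst z + t))"
    have "fst (tangent_step L t z v) = - (k * ?s) + k * B"
      unfolding kB by (simp add: tangent_step_def k_def)
    also have "\<dots> = - (k * (?s - B))"
      by (simp add: right_diff_distrib)
    finally have "\<bar>k\<bar> * \<bar>?s - B\<bar> < L powr (4/5) * \<bar>fst v\<bar>"
      using t by (simp add: bad_noise_def abs_mult)
    moreover have "L * \<bar>fst v\<bar> * \<bar>?s - B\<bar> \<le> \<bar>k\<bar> * \<bar>?s - B\<bar>"
      using k by (intro mult_right_mono) auto
    moreover have "L powr (4/5) = L * L powr (-1/5)"
      using assms powr_add[of L 1 "-1/5"] by simp
    ultimately have "L * \<bar>fst v\<bar> * \<bar>?s - B\<bar> < L * \<bar>fst v\<bar> * L powr (-1/5)"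
      by (simp only: mult.commute[of "\<bar>fst v\<bar>"] mult.assoc)
    then have "\<bar>?s - B\<bar> < L powr (-1/5)"
      using False assms by (subst (asm) mult_less_cancel_left_pos) auto
    with t show "t \<in> {t \<in> {-\<sigma>..\<sigma>}. \<bar>sin (2 * pi * (fst z + t)) - B\<bar> \<le> L powr (-1/5)}" by auto
  qed
  then have "emeasure lborel (bad_noise L z v \<inter> {-\<sigma>..\<sigma>}) \<le>
      emeasure lborel {t \<in> {-\<sigma>..\<sigma>}. \<bar>sin (2 * pi * (fst z + t)) - B\<bar> \<le> L powr (-1/5)}"
    by (rule emeasure_mono) measurable
  also have "\<dots> \<le> ennreal (16 * sqrt (L powr (-1/5)))"
    by (rule emeasure_abs_sin_diff_le) (simp_all add: \<sigma>)
  also have "sqrt (L powr (-1/5)) = L powr (-1/10)"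
    using assms by (simp add: powr_half_sqrt[symmetric] powr_powr)
  \<comment> \<open>Half of the exponent 1/10 is given up to pay for normalising by the interval
    length; this uses \<open>\<delta> \<le> 1/100\<close>.\<close>
  also have "L powr (-1/10) \<le> L powr (- \<delta> + -1/20)"
    using assms by (intro powr_mono) auto
  also have "\<dots> = L powr - \<delta> * L powr (-1/20)"
    by (rule powr_add)
  finally show ?thesis
    by (simp add: \<sigma>_def mult_ac ennreal_leI)
qed

section \<open>Contraction of the negative moment of order 1/200\<close>

text \<open>The failure of some step is bounded by a sum of three indicators, so that each can be
  integrated against its own noise value. On failure, three uses of
  \<open>norm_tangent_step_ge\<close> lose at most \<open>(10 * L) ^ 3\<close>.\<close>

lemma norm_three_steps_powr_le:
  assumes L: "1 \<le> L" "10 \<le> L powr (2/5)" and "v0 \<noteq> 0"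
    and v1: "v1 = tangent_step L t0 z0 v0"
    and v2: "v2 = tangent_step L t1 z1 v1"
    and v3: "v3 = tangent_step L t2 z2 v2"
  shows "norm v3 powr (-1/200) \<le> norm v0 powr (-1/200) * (L powr (-1/200) + 10 * L powr (3/200) *
    (indicator (bad_noise L z0 v0) t0 + indicator (bad_noise L z1 v1) t1 + indicator (bad_noise L z2 v2) t2))"
    (is "_ \<le> _ * (_ + _ * ?I)")
proof (cases "t0 \<notin> bad_noise L z0 v0 \<and> t1 \<notin> bad_noise L z1 v1 \<and> t2 \<notin> bad_noise L z2 v2")
  case True
  then have "L * norm v0 \<le> norm v3"
    using assms by (intro norm_tangent_three_steps_ge[where ?t0.0 = t0 and ?t1.0 = t1 and ?t2.0 = t2])
      auto
  then have "norm v3 powr (-1/200) \<le> (L * norm v0) powr (-1/200)"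
    using assms by (intro powr_mono2') auto
  with True show ?thesis
    using assms by (simp add: powr_mult mult_ac)
next
  case False
  then have I: "1 \<le> ?I"
    by (auto simp: indicator_def)
  have "norm v0 \<le> 10 * L * norm v1" "norm v1 \<le> 10 * L * norm v2" "norm v2 \<le> 10 * L * norm v3"
    unfolding v1 v2 v3 using L by (simp_all add: norm_tangent_step_ge)
  then have "norm v0 \<le> 10 * L * (10 * L * (10 * L * norm v3))"
    using L by (smt (verit) mult_left_mono)
  also have "\<dots> = (10 * L) ^ 3 * norm v3"
    by (simp add: eval_nat_numeral)
  finally have "norm v0 / (10 * L) ^ 3 \<le> norm v3"
    using L by (simp add: divide_le_eq mult_ac)
  then have "norm v3 powr (-1/200) \<le> (norm v0 / (10 * L) ^ 3) powr (-1/200)"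
    using assms by (intro powr_mono2') auto
  also have "\<dots> = norm v0 powr (-1/200) / ((10 * L) ^ 3) powr (-1/200)"
    by (rule powr_divide)
  also have "((10 * L) ^ 3) powr (-1/200) = (10 * L) powr (- 3/200)"
    using L powr_numeral[of "10 * L" "num.Bit1 num.One"] powr_powr[of "10 * L" 3 "-1/200"] by simp
  also have "norm v0 powr (-1/200) / \<dots> = norm v0 powr (-1/200) * (10 * L) powr (3/200)"
    by (simp add: powr_minus_divide)
  also have "(10 * L) powr (3/200) = 10 powr (3/200) * L powr (3/200)"
    using L by (simp add: powr_mult)
  also have "\<dots> \<le> 10 powr 1 * L powr (3/200)"
    by (intro mult_right_mono powr_mono) auto
  also have "\<dots> \<le> 10 * L powr (3/200) * ?I"
    using mult_left_mono[OF I, of "10 * L powr (3/200)"] by simp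
  also have "\<dots> \<le> L powr (-1/200) + 10 * L powr (3/200) * ?I"
    by simp
  finally show ?thesis by (simp add: mult_left_mono)
qed

lemma nn_integral_tangent_iter_Suc:
  assumes "0 < L"
  shows "(\<integral>\<^sup>+\<omega>. ennreal (norm (tangent_iter L \<omega> (Suc n) z v) powr s) \<partial>noise_space L \<delta>) =
    (\<integral>\<^sup>+t. \<integral>\<^sup>+\<omega>. ennreal (norm (tangent_iter L \<omega> n (lift_step L t z) (tangent_step L t z v)) powr s)
      \<partial>noise_space L \<delta> \<partial>noise_law (L powr - \<delta>))"
proof -
  note [measurable] = borel_measurable_norm_tangent_iter
  show ?thesis
    by (subst nn_integral_noise_space_case_nat[OF assms], measurable)
       (simp only: tangent_iter_case_nat)
qed

text \<open>Induction over blocks of three steps, for all \<open>z\<close> and \<open>v\<close> at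
  once because the remaining steps start from a random point and vector. The three noise integrals
  are bounded from the inside out.\<close>

lemma negative_moment_le:
  assumes L: "1 \<le> L" "10 \<le> L powr (2/5)" and \<delta>: "0 < \<delta>" "\<delta> \<le> 1/100"
    and q: "L powr (-1/200) + 240 * L powr (-7/200) \<le> q"
    and "v \<noteq> 0"
  shows "(\<integral>\<^sup>+\<omega>. ennreal (norm (tangent_iter L \<omega> (3 * m) z v) powr (-1/200)) \<partial>noise_space L \<delta>)
    \<le> ennreal (q ^ m * norm v powr (-1/200))"
  using \<open>v \<noteq> 0\<close>
proof (induction m arbitrary: z v)
  case 0
  interpret sequence_space "noise_law (L powr - \<delta>)"
    by (rule sequence_space_noise_law) (use L in simp)
  have "emeasure (noise_space L \<delta>) (space (noise_space L \<delta>)) = 1"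
    unfolding noise_space_def by (rule P.emeasure_space_1)
  then show ?case by simp
next
  case (Suc m)
  define \<sigma> where "\<sigma> = L powr - \<delta>"
  define p where "p = 8 * L powr (-1/20)"
  define c where "c = q ^ m * norm v powr (-1/200)"
  define A where "A = c * L powr (-1/200)"
  define D where "D = c * (10 * L powr (3/200))"
  let ?H = "\<lambda>n z v. \<integral>\<^sup>+\<omega>. ennreal (norm (tangent_iter L \<omega> n z v) powr (-1/200)) \<partial>noise_space L \<delta>"
  have \<sigma>: "0 < \<sigma>" using L by (simp add: \<sigma>_def)
  have p: "0 \<le> p" by (simp add: p_def)
  have q0: "0 \<le> q" by (rule order_trans[OF _ q]) simp
  have c: "0 \<le> c" using q0 by (simp add: c_def)
  have A: "0 \<le> A" and D: "0 \<le> D" using c by (simp_all add: A_def D_def)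
  have leb: "emeasure lborel (bad_noise L z v \<inter> {-\<sigma>..\<sigma>}) \<le> ennreal (2 * \<sigma> * p)" for z v
    unfolding \<sigma>_def p_def using L \<delta> by (intro emeasure_bad_noise_le)
  have step: "?H (Suc n) z w = (\<integral>\<^sup>+t. ?H n (lift_step L t z) (tangent_step L t z w) \<partial>noise_law \<sigma>)" for n z w
    unfolding \<sigma>_def by (rule nn_integral_tangent_iter_Suc) (use L in simp)
  have "?H (3 * Suc m) z v = ?H (Suc (Suc (Suc (3 * m)))) z v"
    by (simp only: mult_Suc_right numeral_3_eq_3 add_Suc add_0)
  also have "\<dots> = (\<integral>\<^sup>+t. ?H (Suc (Suc (3 * m))) (lift_step L t z) (tangent_step L t z v) \<partial>noise_law \<sigma>)"
    by (rule step)
  \<comment> \<open>Each integration replaces one indicator by \<open>p\<close>. The term of the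
    current noise value stands last, to match \<open>nn_integral_noise_law_le\<close>.\<close>
  also have "\<dots> \<le> ennreal ((A + D * p + D * p) + D * p)"
  proof (rule nn_integral_noise_law_le[OF \<sigma> _ D p bad_noise_measurable leb])
    fix t0
    define z1 where "z1 = lift_step L t0 z"
    define v1 where "v1 = tangent_step L t0 z v"
    define I0 where "I0 = (indicator (bad_noise L z v) t0 :: real)"
    have I0: "0 \<le> I0" by (simp add: I0_def)
    have "?H (Suc (Suc (3 * m))) z1 v1 =
        (\<integral>\<^sup>+t. ?H (Suc (3 * m)) (lift_step L t z1) (tangent_step L t z1 v1) \<partial>noise_law \<sigma>)"
      by (rule step)
    also have "\<dots> \<le> ennreal ((A + D * p + D * I0) + D * p)"
    proof (rule nn_integral_noise_law_le[OF \<sigma> _ D p bad_noise_measurable leb])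
      fix t1
      define z2 where "z2 = lift_step L t1 z1"
      define v2 where "v2 = tangent_step L t1 z1 v1"
      define I1 where "I1 = (indicator (bad_noise L z1 v1) t1 :: real)"
      have I1: "0 \<le> I1" by (simp add: I1_def)
      have "?H (Suc (3 * m)) z2 v2 =
          (\<integral>\<^sup>+t. ?H (3 * m) (lift_step L t z2) (tangent_step L t z2 v2) \<partial>noise_law \<sigma>)"
        by (rule step)
      also have "\<dots> \<le> ennreal ((A + D * I0 + D * I1) + D * p)"
      proof (rule nn_integral_noise_law_le[OF \<sigma> _ D p bad_noise_measurable leb])
        fix t2
        define v3 where "v3 = tangent_step L t2 z2 v2"
        have "v3 \<noteq> 0"
          unfolding v3_def v2_def v1_def by (intro tangent_step_nonzero L Suc.prems)
        then have "?H (3 * m) (lift_step L t2 z2) v3 \<le> ennreal (q ^ m * norm v3 powr (-1/200))"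
          by (rule Suc.IH)
        also have "\<dots> \<le> ennreal (q ^ m * (norm v powr (-1/200) * (L powr (-1/200) + 10 * L powr (3/200) *
            (I0 + I1 + indicator (bad_noise L z2 v2) t2))))"
          unfolding I0_def I1_def
          by (intro ennreal_leI mult_left_mono norm_three_steps_powr_le L Suc.prems v1_def v2_def v3_def)
             (simp add: q0)
        also have "\<dots> = ennreal ((A + D * I0 + D * I1) + D * indicator (bad_noise L z2 v2) t2)"
          by (simp add: A_def D_def c_def algebra_simps)
        finally show "?H (3 * m) (lift_step L t2 z2) (tangent_step L t2 z2 v2)
            \<le> ennreal ((A + D * I0 + D * I1) + D * indicator (bad_noise L z2 v2) t2)"
          unfolding v3_def .
      qed (use A D I0 I1 in simp)
      finally show "?H (Suc (3 * m)) (lift_step L t1 z1) (tangent_step L t1 z1 v1)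
          \<le> ennreal ((A + D * p + D * I0) + D * indicator (bad_noise L z1 v1) t1)"
        unfolding z2_def v2_def I1_def by (simp add: add_ac)
    qed (use A D I0 p in simp)
    finally show "?H (Suc (Suc (3 * m))) (lift_step L t0 z) (tangent_step L t0 z v)
        \<le> ennreal ((A + D * p + D * p) + D * indicator (bad_noise L z v) t0)"
      unfolding z1_def v1_def I0_def by (simp add: add_ac)
  qed (use A D p in simp)
  also have "\<dots> \<le> ennreal (q ^ Suc m * norm v powr (-1/200))"
  proof (rule ennreal_leI)
    \<comment> \<open>Here 240 = 3 * 10 * 8: three steps, the constant of
      \<open>norm_three_steps_powr_le\<close>, and the constant in \<open>p\<close>.\<close>
    have "(A + D * p + D * p) + D * p = c * (L powr (-1/200) + 240 * (L powr (3/200) * L powr (-1/20)))"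
      by (simp add: A_def D_def p_def algebra_simps)
    also have "L powr (3/200) * L powr (-1/20) = L powr (-7/200)"
      by (simp flip: powr_add)
    also have "c * (L powr (-1/200) + 240 * \<dots>) \<le> c * q"
      using q c by (rule mult_left_mono)
    finally show "(A + D * p + D * p) + D * p \<le> q ^ Suc m * norm v powr (-1/200)"
      by (simp add: c_def mult_ac)
  qed
  finally show ?case .
qed

section \<open>Exponential Markov inequality and conclusion\<close>

text \<open>The Chernoff bound with parameter 1/200 turns the lower tail of the logarithm into the
  negative moment. The rate is \<open>3/625 = (24/25) * (1/200)\<close>, and the threshold takes
  back \<open>\<alpha> / 200\<close> of it.\<close>

lemma measure_log_norm_le:
  assumes "1 \<le> L" "10 \<le> L powr (2/5)" "0 < \<delta>" "\<delta> \<le> 1/100"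
    and q: "L powr (-1/200) + 240 * L powr (-7/200) \<le> L powr (-3/625)"
    and v: "norm v = 1"
  shows "measure (noise_space L \<delta>)
      {\<omega> \<in> space (noise_space L \<delta>). ln (norm (tangent_iter L \<omega> (3 * m) z v)) \<le> \<alpha> * real m * ln L - C}
    \<le> L powr (- ((24/25 - \<alpha>) / 200) * real m) * exp (- (1/200) * C)"
proof -
  let ?S = "noise_space L \<delta>" and ?N = "\<lambda>\<omega>. norm (tangent_iter L \<omega> (3 * m) z v)"
  let ?a = "\<alpha> * real m * ln L - C"
  note [measurable] = borel_measurable_norm_tangent_iter
  have "v \<noteq> 0" using v by auto
  \<comment> \<open>As \<open>ln 0 = 0\<close> and \<open>0 powr s = 0\<close>, rewriting the
    exponential of the logarithm as a power requires nonzero vectors.\<close>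
  then have nz: "tangent_iter L \<omega> n z v \<noteq> 0" for \<omega> n
    by (induction n) (simp_all add: tangent_step_nonzero assms(1))
  have "emeasure ?S {\<omega> \<in> space ?S. ln (?N \<omega>) \<le> ?a}
      \<le> ennreal (exp (1/200 * ?a)) *
        (\<integral>\<^sup>+\<omega>. ennreal (exp (- (1/200) * ln (?N \<omega>))) * indicator (space ?S) \<omega> \<partial>?S)"
    by (rule Chernoff_ineq_nn_integral_le) simp_all
  also have "(\<integral>\<^sup>+\<omega>. ennreal (exp (- (1/200) * ln (?N \<omega>))) * indicator (space ?S) \<omega> \<partial>?S)
      = (\<integral>\<^sup>+\<omega>. ennreal (?N \<omega> powr (-1/200)) \<partial>?S)"
    by (rule nn_integral_cong) (simp add: powr_def nz)
  also have "\<dots> \<le> ennreal ((L powr (-3/625)) ^ m * norm v powr (-1/200))"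
    using assms v by (intro negative_moment_le) auto
  also have "ennreal (exp (1/200 * ?a)) * \<dots> = ennreal (exp (1/200 * ?a) * (L powr (-3/625)) ^ m)"
    using v by (simp add: ennreal_mult)
  also have "exp (1/200 * ?a) * (L powr (-3/625)) ^ m =
      L powr (- ((24/25 - \<alpha>) / 200) * real m) * exp (- (1/200) * C)"
    using assms(1)
    by (simp add: powr_def exp_of_nat_mult[symmetric] exp_add[symmetric] exp_diff[symmetric] field_simps)
  finally have "emeasure ?S {\<omega> \<in> space ?S. ln (?N \<omega>) \<le> ?a}
      \<le> ennreal (L powr (- ((24/25 - \<alpha>) / 200) * real m) * exp (- (1/200) * C))"
    by (simp add: mult_left_mono)
  then show ?thesis
    unfolding measure_def by (intro enn2real_leI) simp_all
qed

theorem theorem2p6: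
  fixes \<delta>_star :: real
  assumes "0 < \<delta>_star" "\<delta>_star < 1/100"
  shows "\<forall>\<alpha>::real. 0 < \<alpha> \<and> \<alpha> < 24/25 \<longrightarrow>
    (\<exists>r1 r2 L0 :: real. r1 > 0 \<and> r2 > 0 \<and> L0 > 1 \<and>
      (\<forall>(\<delta>::real) L::real. 0 < \<delta> \<and> \<delta> \<le> \<delta>_star \<and> L \<ge> L0 \<longrightarrow>
        (\<forall>(p::torus) (v::real \<times> real) (m::nat) C::real.
           norm v = 1 \<and> m \<ge> 1 \<and> C \<ge> 0 \<longrightarrow>
           measure (noise_space L \<delta>)
             {\<omega> \<in> space (noise_space L \<delta>).
                ln (norm (torus_deriv (random_iter L \<omega> (3 * m)) p v)) \<le> \<alpha> * real m * ln L - C}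
           \<le> L powr (- r1 * real m) * exp (- r2 * C))))"
proof (intro allI impI)
  fix \<alpha> :: real
  assume \<alpha>: "0 < \<alpha> \<and> \<alpha> < 24/25"
  \<comment> \<open>Since 3/625 is strictly below both 1/200 and 7/200, the right side eventually
    dominates the sum. The resulting bound on \<open>L\<close> depends on neither
    \<open>\<alpha>\<close> nor \<open>\<delta>\<close>.\<close>
  have "eventually (\<lambda>L::real. 10 \<le> L powr (2/5) \<and>
      L powr (-1/200) + 240 * L powr (-7/200) \<le> L powr (-3/625)) at_top"
    by (intro eventually_conj; real_asymp)
  then obtain K :: real where K: "\<And>L. K \<le> L \<Longrightarrow> 10 \<le> L powr (2/5) \<and>
      L powr (-1/200) + 240 * L powr (-7/200) \<le> L powr (-3/625)"
    unfolding eventually_at_top_linorder by blast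
  show "\<exists>r1 r2 L0 :: real. r1 > 0 \<and> r2 > 0 \<and> L0 > 1 \<and>
      (\<forall>(\<delta>::real) L::real. 0 < \<delta> \<and> \<delta> \<le> \<delta>_star \<and> L \<ge> L0 \<longrightarrow>
        (\<forall>(p::torus) (v::real \<times> real) (m::nat) C::real.
           norm v = 1 \<and> m \<ge> 1 \<and> C \<ge> 0 \<longrightarrow>
           measure (noise_space L \<delta>)
             {\<omega> \<in> space (noise_space L \<delta>).
                ln (norm (torus_deriv (random_iter L \<omega> (3 * m)) p v)) \<le> \<alpha> * real m * ln L - C}
           \<le> L powr (- r1 * real m) * exp (- r2 * C)))"
  proof (intro exI conjI allI impI)
    show "0 < (24/25 - \<alpha>) / 200" "0 < (1/200 :: real)" "1 < max 2 K"
      using \<alpha> by auto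
    fix \<delta> L C :: real and p :: torus and v :: "real \<times> real" and m :: nat
    assume L: "0 < \<delta> \<and> \<delta> \<le> \<delta>_star \<and> max 2 K \<le> L" and v: "norm v = 1 \<and> 1 \<le> m \<and> 0 \<le> C"
    \<comment> \<open>Any lift of \<open>p\<close> would serve, as the planar estimate is uniform in
      the base point.\<close>
    have p: "p = torus_proj (rep_torus p)"
      by (rule Quotient3_abs_rep[OF Quotient3_torus, symmetric])
    have "1 \<le> L" "\<delta> \<le> 1/100"
      using L assms by auto
    moreover have "10 \<le> L powr (2/5)" "L powr (-1/200) + 240 * L powr (-7/200) \<le> L powr (-3/625)"
      using K[of L] L by auto
    ultimately have "measure (noise_space L \<delta>)
        {\<omega> \<in> space (noise_space L \<delta>).
          ln (norm (tangent_iter L \<omega> (3 * m) (rep_torus p) v)) \<le> \<alpha> * real m * ln L - C}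
        \<le> L powr (- ((24/25 - \<alpha>) / 200) * real m) * exp (- (1/200) * C)"
      using L v by (intro measure_log_norm_le) blast+
    then show "measure (noise_space L \<delta>)
        {\<omega> \<in> space (noise_space L \<delta>).
          ln (norm (torus_deriv (random_iter L \<omega> (3 * m)) p v)) \<le> \<alpha> * real m * ln L - C}
        \<le> L powr (- ((24/25 - \<alpha>) / 200) * real m) * exp (- (1/200) * C)"
      by (subst p) (simp only: torus_deriv_random_iter)
  qed
qed

end
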